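(* Let $S$ be a non-empty set and let $\Lambda$ be a minimal commutative $\mathcal{L}_S$-algebra. Then there exists a unique $\Lambda$-compatible monoid operation $+$, and this operation is commutative.
   Context: $S$ is a fixed non-empty set. An $\mathcal{L}_S$-algebra is a triple $\Lambda=(X,f,x_0)$ with $X$ a non-empty set, $f : S \times X \to X$ a mapping and $x_0 \in X$; for $s\in S$ write $f_s : X \to X$, $f_s(x) = f(s,x)$. A subset $X' \subset X$ is $f$-invariant if $f_s(X') \subset X'$ for every $s \in S$. $\Lambda$ is minimal if the only $f$-invariant subset of $X$ containing $x_0$ is $X$ itself. $\Lambda$ is commutative if $f_s \circ f_t = f_t \circ f_s$ for all $s,t\in S$. A monoid operation on $(X,x_0)$ is an associative binary operation $\bullet$ on $X$ with $x \bullet x_0 = x_0 \bullet x = x$ for all $x \in X$. It is $\Lambda$-compatible if for each $s\in S$ the mapping $f_s$ is a translation in $(X,\bullet,x_0)$, i.e. $f_s(x) = f_s(x_0) \bullet x$ for all $x \in X$. *)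

theory Defs
  imports "HOL-Algebra.Group"
begin

text \<open>
  The map \<open>f : S \<times> X \<rightarrow> X\<close> is curried, so that \<open>f s\<close> is \<open>f\<^sub>s\<close>.
  Its values outside \<open>S\<close> and \<open>X\<close> are irrelevant.
\<close>

locale L_algebra =
  fixes S :: "'s set" and X :: "'x set" and f :: "'s \<Rightarrow> 'x \<Rightarrow> 'x" and x\<^sub>0 :: 'x
  assumes X_nonempty: "X \<noteq> {}"
    and f_maps: "f \<in> S \<rightarrow> X \<rightarrow> X"
    and base_in: "x\<^sub>0 \<in> X"

definition invariant :: "'s set \<Rightarrow> ('s \<Rightarrow> 'x \<Rightarrow> 'x) \<Rightarrow> 'x set \<Rightarrow> bool" where
  "invariant S f X' \<longleftrightarrow> (\<forall>s\<in>S. f s ` X' \<subseteq> X')"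

locale minimal_L_algebra = L_algebra +
  assumes minimal: "\<And>X'. X' \<subseteq> X \<Longrightarrow> invariant S f X' \<Longrightarrow> x\<^sub>0 \<in> X' \<Longrightarrow> X' = X"

locale commutative_L_algebra = L_algebra +
  assumes commutative: "\<And>s t x. s \<in> S \<Longrightarrow> t \<in> S \<Longrightarrow> x \<in> X \<Longrightarrow> (f s \<circ> f t) x = (f t \<circ> f s) x"

text \<open>
  Operations are taken extensional, i.e. \<open>undefined\<close> outside the carrier, so that equality of
  two operations as HOL functions is equality of the maps \<open>X \<times> X \<rightarrow> X\<close>.
\<close>

definition monoid_operation :: "'x set \<Rightarrow> 'x \<Rightarrow> ('x \<Rightarrow> 'x \<Rightarrow> 'x) \<Rightarrow> bool" where
  "monoid_operation X x\<^sub>0 p \<longleftrightarrow>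
     p \<in> X \<rightarrow>\<^sub>E X \<rightarrow>\<^sub>E X \<and> monoid \<lparr>carrier = X, mult = p, one = x\<^sub>0\<rparr>"

definition compatible ::
  "'s set \<Rightarrow> 'x set \<Rightarrow> ('s \<Rightarrow> 'x \<Rightarrow> 'x) \<Rightarrow> 'x \<Rightarrow> ('x \<Rightarrow> 'x \<Rightarrow> 'x) \<Rightarrow> bool" where
  "compatible S X f x\<^sub>0 p \<longleftrightarrow> (\<forall>s\<in>S. \<forall>x\<in>X. f s x = p (f s x\<^sub>0) x)"

end

(* An endomorphism of a minimal algebra is determined by its value at the base point. In the
   commutative case each f s is itself an endomorphism, so every element x is the value at the
   base point of a unique endomorphism endo x, and the monoid operation is x + y = endo x y.
   For any compatible operation the right translations are endomorphisms by associativity,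
   which gives uniqueness. *)
theory Submission
  imports Defs
begin

context L_algebra
begin

text \<open>These are endomorphisms of the \<open>S\<close>-action only: the base point may move,
  and its image is what will label the endomorphism.\<close>

definition endomorphism :: "('x \<Rightarrow> 'x) \<Rightarrow> bool" where
  "endomorphism g \<longleftrightarrow> g \<in> X \<rightarrow> X \<and> (\<forall>s\<in>S. \<forall>x\<in>X. g (f s x) = f s (g x))"

lemma f_closed: "s \<in> S \<Longrightarrow> x \<in> X \<Longrightarrow> f s x \<in> X"
  using f_maps by blast

lemma endomorphismI:
  assumes "\<And>x. x \<in> X \<Longrightarrow> g x \<in> X"
    and "\<And>s x. s \<in> S \<Longrightarrow> x \<in> X \<Longrightarrow> g (f s x) = f s (g x)"
  shows "endomorphism g"
  using assms unfolding endomorphism_def by blast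

lemma endomorphism_closed: "endomorphism g \<Longrightarrow> x \<in> X \<Longrightarrow> g x \<in> X"
  unfolding endomorphism_def by blast

lemma endomorphism_commute:
  "endomorphism g \<Longrightarrow> s \<in> S \<Longrightarrow> x \<in> X \<Longrightarrow> g (f s x) = f s (g x)"
  unfolding endomorphism_def by blast

lemma endomorphism_ident: "endomorphism (\<lambda>x. x)"
  by (rule endomorphismI) simp_all

lemma endomorphism_compose:
  assumes "endomorphism g" and "endomorphism h"
  shows "endomorphism (\<lambda>x. g (h x))"
  using assms by (intro endomorphismI) (simp_all add: endomorphism_closed endomorphism_commute)

text \<open>Compatibility makes each \<open>f s\<close> a left translation, and associativity says
  that left and right translations commute.\<close>

lemma endomorphism_right_translation:
  assumes p: "monoid_operation X x\<^sub>0 p" and "compatible S X f x\<^sub>0 p" and y: "y \<in> X"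
  shows "endomorphism (\<lambda>x. p x y)"
proof -
  interpret M: monoid "\<lparr>carrier = X, mult = p, one = x\<^sub>0\<rparr>"
    using p by (simp add: monoid_operation_def)
  have comp: "f s x = p (f s x\<^sub>0) x" if "s \<in> S" "x \<in> X" for s x
    using assms(2) that by (simp add: compatible_def)
  have closed: "p x z \<in> X" if "x \<in> X" "z \<in> X" for x z
    using M.m_closed that by simp
  show ?thesis
  proof (rule endomorphismI)
    fix s x assume s: "s \<in> S" and x: "x \<in> X"
    have "p (f s x) y = p (p (f s x\<^sub>0) x) y"
      using comp[OF s x] by simp
    also have "\<dots> = p (f s x\<^sub>0) (p x y)"
      using M.m_assoc[of "f s x\<^sub>0" x y] f_closed[OF s base_in] x y by simp
    also have "\<dots> = f s (p x y)"
      using comp[OF s closed[OF x y]] by simp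
    finally show "p (f s x) y = f s (p x y)" .
  qed (rule closed[OF _ y])
qed

end

text \<open>The elements of \<open>X\<close> satisfying \<open>P\<close> form an invariant subset
  containing the base point, so minimality acts as an induction principle.\<close>

lemma (in minimal_L_algebra) minimal_induct [consumes 1, case_names base step]:
  assumes "x \<in> X" and "P x\<^sub>0" and "\<And>s x. s \<in> S \<Longrightarrow> x \<in> X \<Longrightarrow> P x \<Longrightarrow> P (f s x)"
  shows "P x"
proof -
  have "{x \<in> X. P x} = X"
    using assms(2,3) base_in f_closed by (intro minimal) (auto simp: invariant_def)
  with \<open>x \<in> X\<close> show ?thesis by blast
qed

lemma (in minimal_L_algebra) endomorphism_eqI:
  assumes "endomorphism g" and "endomorphism h" and "g x\<^sub>0 = h x\<^sub>0" and "x \<in> X"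
  shows "g x = h x"
  using \<open>x \<in> X\<close> by (induction rule: minimal_induct) (simp_all add: assms endomorphism_commute)

lemma (in commutative_L_algebra) endomorphism_f: "s \<in> S \<Longrightarrow> endomorphism (f s)"
  using commutative by (intro endomorphismI) (simp_all add: f_closed)

locale minimal_commutative_L_algebra = minimal_L_algebra + commutative_L_algebra
begin

lemma ex_endomorphism: "x \<in> X \<Longrightarrow> \<exists>g. endomorphism g \<and> g x\<^sub>0 = x"
proof (induction rule: minimal_induct)
  case base
  show ?case using endomorphism_ident by blast
next
  case (step s x)
  then obtain g where "endomorphism g" "g x\<^sub>0 = x" by blast
  then show ?case
    using endomorphism_compose[OF endomorphism_f[OF \<open>s \<in> S\<close>]] by blast
qed

text \<open>Endomorphisms are determined only on \<open>X\<close> and are arbitrary outside it,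
  hence \<open>SOME\<close> rather than \<open>THE\<close>.\<close>

definition endo :: "'b \<Rightarrow> 'b \<Rightarrow> 'b" where
  "endo x = (SOME g. endomorphism g \<and> g x\<^sub>0 = x)"

lemma endomorphism_endo: "x \<in> X \<Longrightarrow> endomorphism (endo x)"
  and endo_base: "x \<in> X \<Longrightarrow> endo x x\<^sub>0 = x"
  using someI_ex[OF ex_endomorphism] unfolding endo_def by blast+

text \<open>This is how identities for \<open>endo\<close> are obtained: exhibit an endomorphism
  with the right value at the base point.\<close>

lemma endo_eqI:
  assumes g: "endomorphism g" and x: "g x\<^sub>0 = x" and y: "y \<in> X"
  shows "endo x y = g y"
proof -
  have "x \<in> X"
    using endomorphism_closed[OF g base_in] x by simp
  then show ?thesis
    using g x y by (auto intro: endomorphism_eqI[OF endomorphism_endo g] simp: endo_base)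
qed

lemma endo_closed: "x \<in> X \<Longrightarrow> y \<in> X \<Longrightarrow> endo x y \<in> X"
  by (rule endomorphism_closed[OF endomorphism_endo])

lemma endo_base_left: "x \<in> X \<Longrightarrow> endo x\<^sub>0 x = x"
  by (rule endo_eqI[OF endomorphism_ident refl])

lemma endo_f:
  assumes "s \<in> S" and "x \<in> X" and "y \<in> X"
  shows "endo (f s x) y = f s (endo x y)"
  by (rule endo_eqI[OF endomorphism_compose[OF endomorphism_f endomorphism_endo]])
    (simp_all add: assms endo_base)

text \<open>As functions of \<open>z\<close>, both sides are endomorphisms with value
  \<open>endo x y\<close> at the base point.\<close>

lemma endo_assoc:
  assumes "x \<in> X" and "y \<in> X" and "z \<in> X"
  shows "endo (endo x y) z = endo x (endo y z)"
  by (rule endo_eqI[OF endomorphism_compose[OF endomorphism_endo endomorphism_endo]])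
    (simp_all add: assms endo_base)

text \<open>By \<open>endo_f\<close>, evaluation at \<open>y\<close> is an endomorphism in the index
  \<open>x\<close>. It sends the base point to \<open>y\<close>, so it agrees with
  \<open>endo y\<close> on \<open>X\<close>.\<close>

lemma endo_commute:
  assumes "x \<in> X" and "y \<in> X"
  shows "endo x y = endo y x"
proof -
  have "endomorphism (\<lambda>x. endo x y)"
    using \<open>y \<in> X\<close> by (intro endomorphismI) (simp_all add: endo_closed endo_f)
  from endo_eqI[OF this endo_base_left[OF \<open>y \<in> X\<close>] \<open>x \<in> X\<close>] show ?thesis
    by (rule sym)
qed

definition sum_op :: "'b \<Rightarrow> 'b \<Rightarrow> 'b" where
  "sum_op = (\<lambda>x\<in>X. \<lambda>y\<in>X. endo x y)"

lemma sum_op_eq: "x \<in> X \<Longrightarrow> y \<in> X \<Longrightarrow> sum_op x y = endo x y"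
  by (simp add: sum_op_def)

lemma monoid_operation_sum_op: "monoid_operation X x\<^sub>0 sum_op"
  unfolding monoid_operation_def
proof
  show "sum_op \<in> X \<rightarrow>\<^sub>E X \<rightarrow>\<^sub>E X"
    by (auto simp: sum_op_def endo_closed)
  show "monoid \<lparr>carrier = X, mult = sum_op, one = x\<^sub>0\<rparr>"
    by (rule monoidI)
      (simp_all add: sum_op_eq endo_closed endo_assoc endo_base endo_base_left base_in)
qed

lemma compatible_sum_op: "compatible S X f x\<^sub>0 sum_op"
  unfolding compatible_def
proof (intro ballI)
  fix s x assume "s \<in> S" "x \<in> X"
  then show "f s x = sum_op (f s x\<^sub>0) x"
    by (simp add: sum_op_eq f_closed base_in endo_f endo_base_left)
qed

lemma compatible_monoid_operation_unique:
  assumes p: "monoid_operation X x\<^sub>0 p" and c: "compatible S X f x\<^sub>0 p"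
  shows "p = sum_op"
proof -
  interpret M: monoid "\<lparr>carrier = X, mult = p, one = x\<^sub>0\<rparr>"
    using p by (simp add: monoid_operation_def)
  have eq: "p x y = sum_op x y" if x: "x \<in> X" and y: "y \<in> X" for x y
  proof -
    have "p x\<^sub>0 y = y"
      using M.l_one[of y] y by simp
    \<comment> \<open>Right translation by \<open>y\<close> is an endomorphism sending the base
      point to \<open>y\<close>. The arguments come out swapped, which \<open>endo_commute\<close>
      repairs.\<close>
    then have "endo y x = p x y"
      using x by (rule endo_eqI[OF endomorphism_right_translation[OF p c y]])
    then show ?thesis
      using endo_commute[OF x y] x y by (simp add: sum_op_eq)
  qed
  have p_ext: "p \<in> X \<rightarrow>\<^sub>E X \<rightarrow>\<^sub>E X" and sum_ext: "sum_op \<in> X \<rightarrow>\<^sub>E X \<rightarrow>\<^sub>E X"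
    using p monoid_operation_sum_op by (simp_all add: monoid_operation_def)
  show ?thesis
  \<comment> \<open>Agreement on \<open>X\<close> gives equality of functions by applying
    extensionality once per curried argument.\<close>
  proof (rule PiE_ext[OF p_ext sum_ext])
    fix x assume x: "x \<in> X"
    show "p x = sum_op x"
      by (rule PiE_ext[OF PiE_mem[OF p_ext x] PiE_mem[OF sum_ext x]]) (rule eq[OF x])
  qed
qed

end

theorem theorem1p2:
  fixes S :: "'s set" and X :: "'x set" and f :: "'s \<Rightarrow> 'x \<Rightarrow> 'x" and x\<^sub>0 :: 'x
  assumes "S \<noteq> {}"
    and "minimal_L_algebra S X f x\<^sub>0"
    and "commutative_L_algebra S X f x\<^sub>0"
  shows "(\<exists>!p. monoid_operation X x\<^sub>0 p \<and> compatible S X f x\<^sub>0 p) \<and>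
    (\<forall>p. monoid_operation X x\<^sub>0 p \<and> compatible S X f x\<^sub>0 p \<longrightarrow>
      (\<forall>x\<in>X. \<forall>y\<in>X. p x y = p y x))"
proof -
  interpret minimal_commutative_L_algebra S X f x\<^sub>0
    using assms(2,3) by (rule minimal_commutative_L_algebra.intro)
  have "sum_op x y = sum_op y x" if "x \<in> X" "y \<in> X" for x y
    using that by (simp add: sum_op_eq endo_commute)
  then show ?thesis
    \<comment> \<open>By uniqueness any compatible operation is \<open>sum_op\<close>, so it
      inherits commutativity.\<close>
    using monoid_operation_sum_op compatible_sum_op compatible_monoid_operation_unique by blast
qed

end
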